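(* Let $n\ge1$ and let $K$ be a pure $n$-simplicial complex with $p$ vertices. Then $K$ is a simplicial tree if and only if $K$ is connected and $\alpha_k(K)=(p-n)\binom{n}{k}+\binom{n}{k+1}$ for some $1\le k\le n$.
   Context: A simplicial complex on a finite vertex set is a collection of non-empty vertex subsets containing all singletons and closed under non-empty subsets; a $k$-simplex has $k+1$ vertices; $\tau$ is a face of $\sigma$ if $\tau\subseteq\sigma$; $\alpha_k(K)$ is the number of $k$-simplices of $K$. $K$ is a pure $n$-simplicial complex if $\dim K=n$ and every simplex is a face of some $n$-simplex. $\binom{n}{n+1}=0$. Let $0\le m\le n-1$. An $(m,n)$-walk sequence is an alternating sequence $\sigma_1,\eta_1,\sigma_2,\dots,\sigma_r,\eta_r,\sigma_{r+1}$ of $m$-simplices $\sigma_k$ and $n$-simplices $\eta_k$ with $\sigma_k\ne\sigma_{k+1}$ both faces of $\eta_k$; it is an $(m,n)$-path sequence if all its simplices are distinct. $K$ is connected if there is an $(n-1,n)$-path sequence between every pair of distinct $(n-1)$-simplices. An $(m,n)$-simplicial cycle sequence is an $(m,n)$-walk sequence with $\sigma_{r+1}=\sigma_1$, $\sigma_p\neq\sigma_q$ and $\eta_p\ne\eta_q$ for $1\le p\ne q\le r$, such that $r\ge3$, $\sigma_1$ is not a face of $\eta_k$ for $2\le k\le r-1$, and for each $2\le z\le r$ there is an $(n-1)$-simplex $\sigma'_z$ which is a face of $\eta_{z-1}$ and $\eta_z$ and has $\sigma_z$ as a face, with the $\sigma'_z$ pairwise distinct. $K$ is acyclic if it contains no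 $(m,n)$-simplicial cycle sequence for any $0\le m\le n-1$. A simplicial tree is a connected acyclic pure $n$-simplicial complex. *)

theory Defs
  imports Complex_Main
begin

definition abstract_simplicial_complex :: "'a set \<Rightarrow> 'a set set \<Rightarrow> bool" where
  "abstract_simplicial_complex V K \<longleftrightarrow>
     finite V \<and>
     (\<forall>\<sigma>\<in>K. \<sigma> \<noteq> {} \<and> \<sigma> \<subseteq> V) \<and>
     (\<forall>v\<in>V. {v} \<in> K) \<and>
     (\<forall>\<sigma>\<in>K. \<forall>\<tau>. \<tau> \<noteq> {} \<and> \<tau> \<subseteq> \<sigma> \<longrightarrow> \<tau> \<in> K)"

definition simplices :: "'a set set \<Rightarrow> nat \<Rightarrow> 'a set set" where
  "simplices K k = {\<sigma>\<in>K. card \<sigma> = k + 1}"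

definition num_simplices :: "'a set set \<Rightarrow> nat \<Rightarrow> nat" where
  "num_simplices K k = card (simplices K k)"

definition complex_dim :: "'a set set \<Rightarrow> int" where
  "complex_dim K = (if K = {} then -1 else Max ((\<lambda>\<sigma>. int (card \<sigma>) - 1) ` K))"

definition pure_simplicial_complex :: "nat \<Rightarrow> 'a set \<Rightarrow> 'a set set \<Rightarrow> bool" where
  "pure_simplicial_complex n V K \<longleftrightarrow>
     abstract_simplicial_complex V K \<and>
     complex_dim K = int n \<and>
     (\<forall>\<tau>\<in>K. \<exists>\<sigma>\<in>simplices K n. \<tau> \<subseteq> \<sigma>)"

text \<open>
  A sequence \<open>\<sigma>\<^sub>1, \<eta>\<^sub>1, \<sigma>\<^sub>2, \<dots>, \<sigma>\<^sub>r, \<eta>\<^sub>r, \<sigma>\<^sub>r\<^sub>+\<^sub>1\<close> is given by \<open>r\<close> and two functions on \<open>nat\<close>;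
  only \<open>\<sigma>\<close> on \<open>{1..r+1}\<close> and \<open>\<eta>\<close> on \<open>{1..r}\<close> matter.
\<close>

definition walk_sequence ::
    "'a set set \<Rightarrow> nat \<Rightarrow> nat \<Rightarrow> nat \<Rightarrow> (nat \<Rightarrow> 'a set) \<Rightarrow> (nat \<Rightarrow> 'a set) \<Rightarrow> bool" where
  "walk_sequence K m n r \<sigma> \<eta> \<longleftrightarrow>
     1 \<le> r \<and>
     (\<forall>k\<in>{1..r+1}. \<sigma> k \<in> simplices K m) \<and>
     (\<forall>k\<in>{1..r}. \<eta> k \<in> simplices K n) \<and>
     (\<forall>k\<in>{1..r}. \<sigma> k \<noteq> \<sigma> (k+1) \<and> \<sigma> k \<subseteq> \<eta> k \<and> \<sigma> (k+1) \<subseteq> \<eta> k)"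

definition path_sequence ::
    "'a set set \<Rightarrow> nat \<Rightarrow> nat \<Rightarrow> nat \<Rightarrow> (nat \<Rightarrow> 'a set) \<Rightarrow> (nat \<Rightarrow> 'a set) \<Rightarrow> bool" where
  "path_sequence K m n r \<sigma> \<eta> \<longleftrightarrow>
     walk_sequence K m n r \<sigma> \<eta> \<and>
     inj_on \<sigma> {1..r+1} \<and> inj_on \<eta> {1..r} \<and> \<sigma> ` {1..r+1} \<inter> \<eta> ` {1..r} = {}"

definition connected_complex :: "nat \<Rightarrow> 'a set set \<Rightarrow> bool" where
  "connected_complex n K \<longleftrightarrow>
     (\<forall>\<alpha>\<in>simplices K (n-1). \<forall>\<beta>\<in>simplices K (n-1). \<alpha> \<noteq> \<beta> \<longrightarrow>
        (\<exists>r \<sigma> \<eta>. path_sequence K (n-1) n r \<sigma> \<eta> \<and> \<sigma> 1 = \<alpha> \<and> \<sigma> (r+1) = \<beta>))"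

definition cycle_sequence ::
    "'a set set \<Rightarrow> nat \<Rightarrow> nat \<Rightarrow> nat \<Rightarrow> (nat \<Rightarrow> 'a set) \<Rightarrow> (nat \<Rightarrow> 'a set) \<Rightarrow> bool" where
  "cycle_sequence K m n r \<sigma> \<eta> \<longleftrightarrow>
     walk_sequence K m n r \<sigma> \<eta> \<and>
     \<sigma> (r+1) = \<sigma> 1 \<and>
     inj_on \<sigma> {1..r} \<and> inj_on \<eta> {1..r} \<and>
     3 \<le> r \<and>
     (\<forall>k\<in>{2..r-1}. \<not> \<sigma> 1 \<subseteq> \<eta> k) \<and>
     (\<exists>\<sigma>'. inj_on \<sigma>' {2..r} \<and>
        (\<forall>z\<in>{2..r}. \<sigma>' z \<in> simplices K (n-1) \<and>
           \<sigma>' z \<subseteq> \<eta> (z-1) \<and> \<sigma>' z \<subseteq> \<eta> z \<and> \<sigma> z \<subseteq> \<sigma>' z))"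

definition acyclic_complex :: "nat \<Rightarrow> 'a set set \<Rightarrow> bool" where
  "acyclic_complex n K \<longleftrightarrow> (\<forall>m<n. \<not> (\<exists>r \<sigma> \<eta>. cycle_sequence K m n r \<sigma> \<eta>))"

definition simplicial_tree :: "nat \<Rightarrow> 'a set \<Rightarrow> 'a set set \<Rightarrow> bool" where
  "simplicial_tree n V K \<longleftrightarrow>
     pure_simplicial_complex n V K \<and> connected_complex n K \<and> acyclic_complex n K"

end

theory Submission
  imports Defs
begin

text \<open>
  In a connected complex the facets can be listed so that each one shares an \<open>(n-1)\<close>-face with an
  earlier one, hence contributes at most one new vertex. A step with a new vertex adds exactly
  \<open>n choose k\<close> new \<open>k\<close>-simplices, and the first step without one adds at least one \<open>k\<close>-simplex,
  because up to then the facets are precisely the \<open>(n+1)\<close>-cliques. So the count holds for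
  one, equivalently for every, \<open>k\<close> iff every step brings a new vertex (the family is stacked).
  In a stacked family, look at the facet of a putative cycle that was added last: all its shared
  faces avoid its new vertex, so they coincide, which a cycle forbids. Conversely, a step whose
  extra vertex \<open>w\<close> is old closes up a path of facets leaving \<open>w\<close> and returning to it, and a
  shortest such path yields a cycle with \<open>m = 0\<close>.
\<close>

section \<open>Facet families built one facet at a time\<close>

text \<open>Connectedness yields families of this kind. The condition
  \<open>\<eta> \<notin> T\<close> makes every step add a facet, which is what forces a surplus of
  faces when no vertex is new.\<close>

inductive grown :: "nat \<Rightarrow> 'a set set \<Rightarrow> bool" for n where
  base: "card \<eta> = n + 1 \<Longrightarrow> grown n {\<eta>}"
| step: "grown n T \<Longrightarrow> \<zeta> \<in> T \<Longrightarrow> card \<eta> = n + 1 \<Longrightarrow> \<eta> \<notin> T \<Longrightarrow> card (\<eta> \<inter> \<zeta>) = n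
    \<Longrightarrow> grown n (insert \<eta> T)"

inductive stacked :: "nat \<Rightarrow> 'a set set \<Rightarrow> bool" for n where
  base: "card \<eta> = n + 1 \<Longrightarrow> stacked n {\<eta>}"
| step: "stacked n T \<Longrightarrow> \<zeta> \<in> T \<Longrightarrow> card \<eta> = n + 1 \<Longrightarrow> card (\<eta> \<inter> \<zeta>) = n
    \<Longrightarrow> v \<in> \<eta> \<Longrightarrow> v \<notin> \<Union>T \<Longrightarrow> stacked n (insert \<eta> T)"

text \<open>Generated by the family alone, without an ambient complex, so that faces can be counted
  by induction on the family.\<close>

definition faces :: "nat \<Rightarrow> 'a set set \<Rightarrow> 'a set set" where
  "faces k T = {s. card s = k + 1 \<and> (\<exists>\<eta>\<in>T. s \<subseteq> \<eta>)}"

lemma inter_eq_remove: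
  assumes "card A = n + 1" "card (A \<inter> B) = n" "x \<in> A" "x \<notin> B"
  shows "A \<inter> B = A - {x}"
proof (rule card_subset_eq)
  have "finite A" using assms(1) by (simp add: card_ge_0_finite)
  then show "finite (A - {x})" "card (A \<inter> B) = card (A - {x})"
    using assms by auto
qed (use assms in auto)

lemma card_Suc_eq_subset:
  assumes "card A = n + 1" "card B = n + 1" "A \<subseteq> B"
  shows "A = B"
  using assms by (metis card_ge_0_finite card_subset_eq zero_less_Suc Suc_eq_plus1)

lemma card_inter_le:
  assumes "card A = n + 1" "card B = n + 1" "A \<noteq> B"
  shows "card (A \<inter> B) \<le> n"
proof -
  have "finite A" using assms(1) by (simp add: card_ge_0_finite)
  moreover have "A \<inter> B \<subset> A" using card_Suc_eq_subset[OF assms(1,2)] assms(3) by blast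
  ultimately have "card (A \<inter> B) < card A" by (rule psubset_card_mono)
  then show ?thesis using assms(1) by simp
qed

lemma grown_finite:
  assumes "grown n T"
  shows "finite T \<and> (\<forall>\<eta>\<in>T. finite \<eta> \<and> card \<eta> = n + 1)"
  using assms by induction (auto simp: card_ge_0_finite)

lemma stacked_imp_grown: "stacked n T \<Longrightarrow> grown n T"
proof (induction rule: stacked.induct)
  case (base \<eta>)
  then show ?case by (rule grown.base)
next
  case (step T \<zeta> \<eta> v)
  then have "\<eta> \<notin> T" by blast
  then show ?case using step grown.step by metis
qed

section \<open>Face counts when a facet with a new vertex is added\<close>

lemma finite_faces:
  assumes "finite T" "\<forall>\<eta>\<in>T. finite \<eta>"
  shows "finite (faces k T)"
  by (rule finite_subset[of _ "Pow (\<Union>T)"]) (use assms in \<open>auto simp: faces_def\<close>)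

text \<open>Since \<open>\<eta> - {v}\<close> lies inside \<open>\<zeta>\<close>, a subset of
  \<open>\<eta>\<close> avoiding \<open>v\<close> is an old face; one containing \<open>v\<close> is
  determined by its other \<open>k\<close> vertices.\<close>

lemma faces_insert_new_vertex:
  assumes "card \<eta> = n + 1" "\<zeta> \<in> T" "card (\<eta> \<inter> \<zeta>) = n" "v \<in> \<eta>" "v \<notin> \<Union>T"
  shows "faces k (insert \<eta> T) = faces k T \<union> insert v ` {s. s \<subseteq> \<eta> - {v} \<and> card s = k}"
proof -
  have fin: "finite \<eta>" using assms(1) by (simp add: card_ge_0_finite)
  have "\<eta> \<inter> \<zeta> = \<eta> - {v}" using assms by (intro inter_eq_remove) auto
  then have sub: "\<eta> - {v} \<subseteq> \<zeta>" by blast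
  have old: "s \<in> faces k T" if "s \<subseteq> \<eta>" "card s = k + 1" "v \<notin> s" for s
    using that sub assms(2) unfolding faces_def by blast
  have new: "s \<in> insert v ` {s. s \<subseteq> \<eta> - {v} \<and> card s = k}"
    if "s \<subseteq> \<eta>" "card s = k + 1" "v \<in> s" for s
  proof (rule image_eqI)
    show "s = insert v (s - {v})" using that by auto
    show "s - {v} \<in> {s. s \<subseteq> \<eta> - {v} \<and> card s = k}" using that by auto
  qed
  have conv: "card (insert v s) = k + 1 \<and> insert v s \<subseteq> \<eta>"
    if "s \<subseteq> \<eta> - {v}" "card s = k" for s
  proof -
    have "finite s" using that fin finite_subset by blast
    then show ?thesis using that assms(4) by (auto simp: card_insert_if)
  qed
  show ?thesis
  proof (intro equalityI subsetI)
    fix s assume "s \<in> faces k (insert \<eta> T)"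
    then have "s \<in> faces k T \<or> (s \<subseteq> \<eta> \<and> card s = k + 1)" by (auto simp: faces_def)
    then show "s \<in> faces k T \<union> insert v ` {s. s \<subseteq> \<eta> - {v} \<and> card s = k}" using old new by blast
  next
    fix s assume "s \<in> faces k T \<union> insert v ` {s. s \<subseteq> \<eta> - {v} \<and> card s = k}"
    then consider "s \<in> faces k T" | t where "t \<subseteq> \<eta> - {v}" "card t = k" "s = insert v t" by blast
    then show "s \<in> faces k (insert \<eta> T)"
    proof cases
      case 2
      then show ?thesis using conv[of t] by (simp add: faces_def)
    qed (auto simp: faces_def)
  qed
qed

text \<open>All added faces contain \<open>v\<close>, so none is old, and \<open>insert v\<close> is
  injective on sets avoiding \<open>v\<close>. The rest of \<open>\<eta>\<close> lies in
  \<open>\<zeta>\<close>, so \<open>v\<close> is the only vertex gained.\<close>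

lemma card_faces_insert_new_vertex:
  assumes "finite T" "\<forall>\<eta>\<in>T. finite \<eta>"
    and "card \<eta> = n + 1" "\<zeta> \<in> T" "card (\<eta> \<inter> \<zeta>) = n" "v \<in> \<eta>" "v \<notin> \<Union>T"
  shows "card (faces k (insert \<eta> T)) = card (faces k T) + (n choose k)"
    and "card (\<Union>(insert \<eta> T)) = card (\<Union>T) + 1"
proof -
  let ?N = "insert v ` {s. s \<subseteq> \<eta> - {v} \<and> card s = k}"
  have fin: "finite \<eta>" using assms(3) by (simp add: card_ge_0_finite)
  have "inj_on (insert v) {s. s \<subseteq> \<eta> - {v} \<and> card s = k}"
    by (rule inj_onI) (auto simp: insert_ident)
  then have "card ?N = n choose k"
    using n_subsets[of "\<eta> - {v}" k] fin assms(3,6) by (simp add: card_image)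
  moreover have "finite ?N" using fin by simp
  moreover have "faces k T \<inter> ?N = {}" using assms(7) by (auto simp: faces_def)
  ultimately show "card (faces k (insert \<eta> T)) = card (faces k T) + (n choose k)"
    using faces_insert_new_vertex[OF assms(3-7), of k] finite_faces[OF assms(1,2), of k]
    by (simp add: card_Un_disjoint)
  have "\<eta> \<inter> \<zeta> = \<eta> - {v}" using assms by (intro inter_eq_remove) auto
  then have "\<Union>(insert \<eta> T) = insert v (\<Union>T)" using assms(4,6) by auto
  then show "card (\<Union>(insert \<eta> T)) = card (\<Union>T) + 1" using assms by simp
qed

lemma faces_singleton:
  assumes "card \<eta> = n + 1"
  shows "card (faces k {\<eta>}) = (n choose k) + (n choose (k + 1))"
proof -
  have "faces k {\<eta>} = {s. s \<subseteq> \<eta> \<and> card s = k + 1}" by (auto simp: faces_def)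
  moreover have "finite \<eta>" using assms by (simp add: card_ge_0_finite)
  ultimately have "card (faces k {\<eta>}) = (n + 1) choose (k + 1)"
    using n_subsets[of \<eta> "k + 1"] assms by simp
  \<comment> \<open>Pascal's rule splits the binomial coefficient into the shape of the
    formula.\<close>
  then show ?thesis by simp
qed

text \<open>The predicted number of \<open>k\<close>-simplices, with the vertices read off from the
  family. It is affine in the number of vertices with slope \<open>n choose k\<close>; integers
  avoid truncated subtraction.\<close>

definition tree_count :: "nat \<Rightarrow> nat \<Rightarrow> 'a set set \<Rightarrow> int" where
  "tree_count n k T = (int (card (\<Union>T)) - int n) * int (n choose k) + int (n choose (k + 1))"

lemma tree_count_singleton:
  "card \<eta> = n + 1 \<Longrightarrow> tree_count n k {\<eta>} = int (card (faces k {\<eta>}))"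
  unfolding tree_count_def by (simp only: faces_singleton) simp

lemma tree_count_insert_new_vertex:
  assumes "finite T" "\<forall>\<eta>\<in>T. finite \<eta>"
    and "card \<eta> = n + 1" "\<zeta> \<in> T" "card (\<eta> \<inter> \<zeta>) = n" "v \<in> \<eta>" "v \<notin> \<Union>T"
  shows "tree_count n k (insert \<eta> T) = tree_count n k T + int (n choose k)"
  using card_faces_insert_new_vertex(2)[OF assms] unfolding tree_count_def
  by (simp only:) (simp add: algebra_simps)

text \<open>Both sides agree on a single facet and grow by \<open>n choose k\<close> with each new
  vertex.\<close>

lemma stacked_card_faces:
  assumes "stacked n T"
  shows "int (card (faces k T)) = tree_count n k T"
  using assms
proof induction
  case (base \<eta>)
  then show ?case by (simp add: tree_count_singleton)
next
  case (step T \<zeta> \<eta> v)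
  have fin: "finite T" "\<forall>\<eta>\<in>T. finite \<eta>"
    using grown_finite[OF stacked_imp_grown[OF step.hyps(1)]] by auto
  show ?case
    using card_faces_insert_new_vertex(1)[OF fin step.hyps(3,2,4,5,6), where k=k]
      tree_count_insert_new_vertex[OF fin step.hyps(3,2,4,5,6), where k=k] step.IH
    by (simp del: Union_insert)
qed

section \<open>Cliques in stacked families and the excess of faces otherwise\<close>

text \<open>Consider the last vertex \<open>v\<close>, which lies in \<open>\<eta>\<close> only. If
  \<open>v\<close> is in \<open>e\<close>, every vertex of \<open>e\<close> shares a facet with
  \<open>v\<close>, so \<open>e\<close> is \<open>\<eta>\<close>. Otherwise any pair joined through
  \<open>\<eta>\<close> lies in \<open>\<eta> - {v}\<close>, hence in \<open>\<zeta>\<close>, and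
  \<open>e\<close> is already a clique over \<open>T\<close>.\<close>

lemma stacked_clique:
  assumes "stacked n T" "card e = n + 1" "\<forall>x\<in>e. \<forall>y\<in>e. \<exists>\<eta>\<in>T. x \<in> \<eta> \<and> y \<in> \<eta>"
  shows "e \<in> T"
  using assms
proof (induction)
  case (base \<eta>)
  then have "e \<subseteq> \<eta>" by blast
  then show ?case using card_Suc_eq_subset base by blast
next
  case (step T \<zeta> \<eta> v)
  have eq: "\<eta> \<inter> \<zeta> = \<eta> - {v}" using step.hyps by (intro inter_eq_remove) auto
  show ?case
  proof (cases "v \<in> e")
    case True
    then have "e \<subseteq> \<eta>" using step.prems(2) step.hyps(6) by blast
    then show ?thesis using card_Suc_eq_subset step by blast
  next
    case False
    have "\<exists>\<theta>\<in>T. x \<in> \<theta> \<and> y \<in> \<theta>" if xy: "x \<in> e" "y \<in> e" for x y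
    proof -
      obtain \<theta> where "\<theta> \<in> insert \<eta> T" "x \<in> \<theta>" "y \<in> \<theta>" using step.prems(2) xy by meson
      moreover have "x \<in> \<zeta> \<and> y \<in> \<zeta>" if "\<theta> = \<eta>"
      proof -
        have "x \<in> \<eta> - {v}" "y \<in> \<eta> - {v}"
          using False xy \<open>x \<in> \<theta>\<close> \<open>y \<in> \<theta>\<close> that by auto
        then show ?thesis unfolding eq[symmetric] by simp
      qed
      ultimately show ?thesis using step.hyps(2) by (cases "\<theta> = \<eta>") auto
    qed
    then show ?thesis using step.IH step.prems(1) by blast
  qed
qed

text \<open>As \<open>k \<ge> 1\<close>, each pair of vertices of \<open>e\<close> extends to a
  subset of size \<open>k + 1\<close>. If all of these were old, \<open>e\<close> would be a clique
  and so belong to \<open>T\<close>.\<close>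

lemma stacked_new_face:
  assumes "stacked n T" "card e = n + 1" "e \<notin> T" "1 \<le> k" "k \<le> n"
  shows "\<exists>s. s \<subseteq> e \<and> card s = k + 1 \<and> s \<notin> faces k T"
proof (rule ccontr)
  assume neg: "\<not> ?thesis"
  have fin: "finite e" using assms(2) by (simp add: card_ge_0_finite)
  have "\<exists>\<eta>\<in>T. x \<in> \<eta> \<and> y \<in> \<eta>" if "x \<in> e" "y \<in> e" for x y
  proof -
    have "card {x, y} \<le> k + 1" using assms(4) by (simp add: card_insert_if)
    moreover have "k + 1 \<le> card e" "{x, y} \<subseteq> e" using assms(2,5) that by auto
    ultimately obtain s where "{x, y} \<subseteq> s" "s \<subseteq> e" "card s = k + 1"
      using exists_subset_between[of "{x, y}" "k + 1" e] fin by blast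
    moreover from this have "s \<in> faces k T" using neg by blast
    ultimately show ?thesis unfolding faces_def by auto
  qed
  then show False using stacked_clique assms by blast
qed

text \<open>A new vertex raises both counts equally; a step without one keeps
  \<open>tree_count\<close> and loses no face, so an excess persists. The first such step starts
  from a stacked family and creates an excess by \<open>stacked_new_face\<close>.\<close>

lemma grown_card_faces:
  assumes "grown n T" "1 \<le> k" "k \<le> n"
  shows "stacked n T \<or> int (card (faces k T)) > tree_count n k T"
  using assms
proof (induction)
  case (base \<eta>)
  then show ?case by (simp add: stacked.base)
next
  case (step T \<zeta> \<eta>)
  have fin: "finite T" "\<forall>\<eta>\<in>T. finite \<eta>"
    using grown_finite[OF step.hyps(1)] by auto
  have fin\<eta>: "finite \<eta>" using step.hyps(3) by (simp add: card_ge_0_finite)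
  show ?case
  proof (cases "\<eta> \<subseteq> \<Union>T")
    case False
    then obtain v where v: "v \<in> \<eta>" "v \<notin> \<Union>T" by blast
    show ?thesis
    proof (cases "stacked n T")
      case True
      then show ?thesis using stacked.step[OF _ step.hyps(2,3,5) v] by blast
    next
      case False
      then show ?thesis using step
          card_faces_insert_new_vertex(1)[OF fin step.hyps(3,2,5) v, where k=k]
          tree_count_insert_new_vertex[OF fin step.hyps(3,2,5) v, where k=k]
        by (simp del: Union_insert)
    qed
  next
    case True
    then have "\<Union>(insert \<eta> T) = \<Union>T" by blast
    then have tc: "tree_count n k (insert \<eta> T) = tree_count n k T"
      unfolding tree_count_def by (simp only:)
    have sub: "faces k T \<subseteq> faces k (insert \<eta> T)" unfolding faces_def by blast
    have fin': "finite (faces k (insert \<eta> T))" by (rule finite_faces) (use fin fin\<eta> in auto)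
    show ?thesis
    proof (cases "stacked n T")
      case True
      obtain s where "s \<subseteq> \<eta>" "card s = k + 1" "s \<notin> faces k T"
        using stacked_new_face[OF True step.hyps(3,4) step.prems] by blast
      then have "faces k T \<subset> faces k (insert \<eta> T)" using sub unfolding faces_def by blast
      then have "card (faces k T) < card (faces k (insert \<eta> T))"
        using fin' by (intro psubset_card_mono)
      then show ?thesis using tc stacked_card_faces[OF True, of k] by linarith
    next
      case False
      then have "int (card (faces k T)) > tree_count n k T" using step by blast
      moreover have "card (faces k T) \<le> card (faces k (insert \<eta> T))"
        using fin' sub by (intro card_mono)
      ultimately show ?thesis using tc by linarith
    qed
  qed
qed

section \<open>From connectedness to a growth order\<close>

text \<open>Otherwise a facet sharing an \<open>(n-1)\<close>-simplex with a member of
  \<open>T\<close> is itself in \<open>T\<close>, so a path sequence that starts below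
  \<open>T\<close> can never leave it.\<close>

lemma connected_complex_cross:
  assumes "1 \<le> n" "abstract_simplicial_complex V K" "connected_complex n K"
    and T: "T \<subseteq> simplices K n" "T \<noteq> {}" "T \<noteq> simplices K n"
  shows "\<exists>\<eta>\<in>simplices K n - T. \<exists>\<zeta>\<in>T. card (\<eta> \<inter> \<zeta>) = n"
proof (rule ccontr)
  assume neg: "\<not> ?thesis"
  have closed: "\<eta> \<in> T" if "\<eta> \<in> simplices K n" "\<zeta> \<in> T" "s \<subseteq> \<eta>" "s \<subseteq> \<zeta>" "card s = n" for \<eta> \<zeta> s
  proof (rule ccontr)
    assume nT: "\<eta> \<notin> T"
    have cards: "card \<eta> = n + 1" "card \<zeta> = n + 1" using that T unfolding simplices_def by auto
    have "card (\<eta> \<inter> \<zeta>) \<le> n" using card_inter_le[OF cards] nT that by blast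
    moreover have "finite \<eta>" using cards by (simp add: card_ge_0_finite)
    then have "card s \<le> card (\<eta> \<inter> \<zeta>)" using that by (intro card_mono) auto
    ultimately have "card (\<eta> \<inter> \<zeta>) = n" using that by linarith
    then show False using neg nT that by blast
  qed
  have facet: "\<exists>s\<in>simplices K (n - 1). s \<subseteq> \<eta>" if "\<eta> \<in> simplices K n" for \<eta>
  proof -
    have "card \<eta> = n + 1" "\<eta> \<in> K" using that unfolding simplices_def by auto
    moreover obtain s where s: "s \<subseteq> \<eta>" "card s = n"
      using obtain_subset_with_card_n[of n \<eta>] \<open>card \<eta> = n + 1\<close> by auto
    moreover have "s \<noteq> {}" using s assms(1) by auto
    ultimately have "s \<in> K" using assms(2) unfolding abstract_simplicial_complex_def by blast
    then show ?thesis using s assms(1) unfolding simplices_def by auto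
  qed
  obtain \<zeta> \<eta> where \<zeta>: "\<zeta> \<in> T" and \<eta>: "\<eta> \<in> simplices K n" "\<eta> \<notin> T" using T by blast
  obtain \<alpha> where \<alpha>: "\<alpha> \<in> simplices K (n - 1)" "\<alpha> \<subseteq> \<zeta>" using facet \<zeta> T by blast
  obtain \<beta> where \<beta>: "\<beta> \<in> simplices K (n - 1)" "\<beta> \<subseteq> \<eta>" using facet \<eta> by blast
  have cn: "card s = n" if "s \<in> simplices K (n - 1)" for s
    using that assms(1) unfolding simplices_def by auto
  have "\<alpha> \<noteq> \<beta>" using closed \<zeta> \<eta> \<alpha> \<beta> cn by blast
  then obtain r \<sigma> e where path: "path_sequence K (n - 1) n r \<sigma> e" "\<sigma> 1 = \<alpha>" "\<sigma> (r + 1) = \<beta>"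
    using assms(3) \<alpha>(1) \<beta>(1) unfolding connected_complex_def by blast
  then have w: "walk_sequence K (n - 1) n r \<sigma> e" unfolding path_sequence_def by blast
  \<comment> \<open>Invariant along the path; the offset is there because sequences start at index
    1.\<close>
  have "\<exists>\<theta>\<in>T. \<sigma> (i + 1) \<subseteq> \<theta>" if "i \<le> r" for i
    using that
  proof (induction i)
    case 0
    then show ?case using path \<alpha> \<zeta> by auto
  next
    case (Suc i)
    then obtain \<theta> where \<theta>: "\<theta> \<in> T" "\<sigma> (i + 1) \<subseteq> \<theta>" by auto
    have i: "i + 1 \<in> {1..r}" "i + 1 \<in> {1..r + 1}" using Suc by auto
    then have *: "e (i + 1) \<in> simplices K n" "\<sigma> (i + 1) \<subseteq> e (i + 1)"
      "\<sigma> (i + 1 + 1) \<subseteq> e (i + 1)" "\<sigma> (i + 1) \<in> simplices K (n - 1)"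
      using w unfolding walk_sequence_def by blast+
    then have "e (i + 1) \<in> T" using closed \<theta> cn by blast
    then show ?case using * by auto
  qed
  from this[of r] obtain \<theta> where "\<theta> \<in> T" "\<beta> \<subseteq> \<theta>" using path by auto
  then show False using closed \<eta> \<beta> cn by blast
qed

text \<open>A maximal grown subfamily of the facets must be everything, since a crossing facet would
  extend it.\<close>

lemma connected_imp_grown:
  assumes "1 \<le> n" "abstract_simplicial_complex V K" "connected_complex n K"
    and ne: "simplices K n \<noteq> {}" and fin: "finite (simplices K n)"
  shows "grown n (simplices K n)"
proof -
  let ?F = "simplices K n"
  obtain \<eta>0 where "\<eta>0 \<in> ?F" using ne by blast
  then have "{\<eta>0} \<in> {T. grown n T \<and> T \<subseteq> ?F}" by (auto simp: simplices_def intro: grown.base)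
  then have "{T. grown n T \<and> T \<subseteq> ?F} \<noteq> {}" by blast
  moreover have "finite {T. grown n T \<and> T \<subseteq> ?F}" using fin by simp
  ultimately obtain T where "T \<in> {T. grown n T \<and> T \<subseteq> ?F}"
    and "\<forall>U\<in>{T. grown n T \<and> T \<subseteq> ?F}. T \<subseteq> U \<longrightarrow> T = U"
    using finite_has_maximal by meson
  then have T: "grown n T" "T \<subseteq> ?F"
    and max: "\<And>U. grown n U \<Longrightarrow> U \<subseteq> ?F \<Longrightarrow> T \<subseteq> U \<Longrightarrow> U = T"
    by auto
  have "T \<noteq> {}" using T(1) by cases auto
  show ?thesis
  proof (rule ccontr)
    assume "\<not> ?thesis"
    then have "T \<noteq> ?F" using T by auto
    then obtain \<eta> \<zeta> where *: "\<eta> \<in> ?F" "\<eta> \<notin> T" "\<zeta> \<in> T" "card (\<eta> \<inter> \<zeta>) = n"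
      using connected_complex_cross[OF assms(1-3) T(2) \<open>T \<noteq> {}\<close>] by blast
    then have "grown n (insert \<eta> T)"
      using T by (intro grown.step) (auto simp: simplices_def)
    then show False using max[of "insert \<eta> T"] T * by blast
  qed
qed

section \<open>Stacked families contain no cycle\<close>

lemma stacked_no_cycle:
  assumes "stacked n T" "1 \<le> n" "cycle_sequence K m n r \<sigma> \<eta>" "\<eta> ` {1..r} \<subseteq> T"
  shows False
  using assms
proof (induction)
  case (base e)
  have inj: "inj_on \<eta> {1..r}" and r: "3 \<le> r" using base unfolding cycle_sequence_def by auto
  have "1 \<in> {1..r}" "2 \<in> {1..r}" using r by auto
  moreover from this have "\<eta> 1 = \<eta> 2" using base.prems(3) by blast
  ultimately have "(1::nat) = 2" using inj_onD[OF inj] by blast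
  then show ?case by simp
next
  case (step T \<zeta> e v)
  have inj: "inj_on \<eta> {1..r}" and r: "3 \<le> r" and last: "\<sigma> (r + 1) = \<sigma> 1"
    and avoid: "\<forall>k\<in>{2..r-1}. \<not> \<sigma> 1 \<subseteq> \<eta> k" and w: "walk_sequence K m n r \<sigma> \<eta>"
    using step.prems unfolding cycle_sequence_def by auto
  obtain s where inj': "inj_on s {2..r}" and s: "\<And>z. z \<in> {2..r} \<Longrightarrow> s z \<in> simplices K (n-1) \<and>
           s z \<subseteq> \<eta> (z-1) \<and> s z \<subseteq> \<eta> z"
    using step.prems(2) unfolding cycle_sequence_def by blast
  have "\<sigma> 1 \<subseteq> \<eta> 1" "\<sigma> (r + 1) \<subseteq> \<eta> r" using w r unfolding walk_sequence_def by auto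
  then have ends: "\<sigma> 1 \<subseteq> \<eta> 1" "\<sigma> 1 \<subseteq> \<eta> r" using last by auto
  show False
  proof (cases "e \<in> \<eta> ` {1..r}")
    case False
    then show ?thesis using step by blast
  next
    case True
    then obtain k where k: "k \<in> {1..r}" "\<eta> k = e" by blast
    have other: "v \<notin> \<eta> j" if "j \<in> {1..r}" "j \<noteq> k" for j
    proof -
      have "\<eta> j \<noteq> e" using inj_onD[OF inj, of j k] that k by auto
      then show ?thesis using step.prems(3) step.hyps(6) that by blast
    qed
    have fin: "finite e" using step.hyps(3) by (simp add: card_ge_0_finite)
    \<comment> \<open>The neighbour of \<open>e\<close> in the cycle misses \<open>v\<close>, so the
      shared \<open>(n-1)\<close>-simplex lies in \<open>e - {v}\<close> and fills it by
      cardinality.\<close>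
    have shared: "s z = e - {v}" if "z \<in> {2..r}" "z = k \<or> z - 1 = k" for z
    proof (rule card_subset_eq)
      have "v \<notin> s z"
      proof (cases "z = k")
        case True
        have "v \<notin> \<eta> (z - 1)" by (rule other) (use that True in auto)
        then show ?thesis using s[OF that(1)] by blast
      next
        case False
        then have "v \<notin> \<eta> z" using that by (intro other) auto
        then show ?thesis using s[OF that(1)] by blast
      qed
      then show "s z \<subseteq> e - {v}" using s[OF that(1)] that(2) k(2) by blast
      show "finite (e - {v})" using fin by simp
      show "card (s z) = card (e - {v})"
        using s[OF that(1)] step.hyps fin assms(2) by (simp add: simplices_def)
    qed
    \<comment> \<open>In the interior, the shared faces on both sides of \<open>e\<close> coincide.
      At an end, \<open>\<sigma> 1\<close> lies in both end facets, hence in the shared face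
      \<open>e - {v}\<close>, and so in the facet next to \<open>e\<close>, which has to avoid
      it.\<close>
    consider "k = 1" | "k = r" | "2 \<le> k" "k < r" using k by fastforce
    then show False
    proof cases
      case 1
      have "v \<notin> \<eta> r" using 1 r by (intro other) auto
      then have "\<sigma> 1 \<subseteq> e - {v}" using ends k 1 by blast
      then have "\<sigma> 1 \<subseteq> s 2" using shared[of 2] 1 r by auto
      then have "\<sigma> 1 \<subseteq> \<eta> 2" using s[of 2] r by auto
      moreover have "2 \<in> {2..r-1}" using r by auto
      ultimately show False using avoid by blast
    next
      case 2
      have "v \<notin> \<eta> 1" using 2 r by (intro other) auto
      then have "\<sigma> 1 \<subseteq> e - {v}" using ends k 2 by blast
      then have "\<sigma> 1 \<subseteq> s r" using shared[of r] 2 r by auto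
      then have "\<sigma> 1 \<subseteq> \<eta> (r - 1)" using s[of r] r by auto
      moreover have "r - 1 \<in> {2..r-1}" using r by auto
      ultimately show False using avoid by blast
    next
      case 3
      then have "s k = s (k + 1)" using shared[of k] shared[of "k + 1"] by auto
      then show False using inj_onD[OF inj', of k "k + 1"] 3 by auto
    qed
  qed
qed

section \<open>Returning facet paths and the cycles they yield\<close>

text \<open>The consecutive intersections will serve as the \<open>(n-1)\<close>-simplices
  \<open>\<sigma>'\<close> of a cycle sequence, hence their injectivity.\<close>

definition facet_path :: "nat \<Rightarrow> 'a set set \<Rightarrow> nat \<Rightarrow> (nat \<Rightarrow> 'a set) \<Rightarrow> bool" where
  "facet_path n F r \<eta> \<longleftrightarrow>
     (\<forall>k\<in>{1..r}. \<eta> k \<in> F) \<and> inj_on \<eta> {1..r} \<and>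
     (\<forall>k\<in>{1..<r}. card (\<eta> k \<inter> \<eta> (k + 1)) = n) \<and>
     inj_on (\<lambda>k. \<eta> k \<inter> \<eta> (k + 1)) {1..<r}"

definition returning_path ::
    "nat \<Rightarrow> 'a set set \<Rightarrow> nat \<Rightarrow> (nat \<Rightarrow> 'a set) \<Rightarrow> 'a \<Rightarrow> bool" where
  "returning_path n F r \<eta> w \<longleftrightarrow>
     facet_path n F r \<eta> \<and> 3 \<le> r \<and> w \<in> \<eta> 1 \<and> w \<in> \<eta> r \<and> (\<forall>k\<in>{2..r-1}. w \<notin> \<eta> k)"

lemma facet_path_shift:
  assumes "facet_path n F r \<eta>" "i + s \<le> r"
  shows "facet_path n F s (\<lambda>k. \<eta> (k + i))"
proof -
  have "inj_on \<eta> {1..r}" "inj_on (\<lambda>k. \<eta> k \<inter> \<eta> (k + 1)) {1..<r}"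
    using assms(1) unfolding facet_path_def by auto
  moreover have "(\<lambda>k. k + i) ` {1..s} \<subseteq> {1..r}" "(\<lambda>k. k + i) ` {1..<s} \<subseteq> {1..<r}"
    using assms(2) by auto
  ultimately have inj: "inj_on (\<eta> \<circ> (\<lambda>k. k + i)) {1..s}"
    "inj_on ((\<lambda>k. \<eta> k \<inter> \<eta> (k + 1)) \<circ> (\<lambda>k. k + i)) {1..<s}"
    by (auto intro!: comp_inj_on inj_on_add' elim: inj_on_subset)
  show ?thesis
    unfolding facet_path_def
  proof (intro conjI ballI)
    show "\<eta> (k + i) \<in> F" if "k \<in> {1..s}" for k
      using assms that unfolding facet_path_def by auto
    show "card (\<eta> (k + i) \<inter> \<eta> (k + 1 + i)) = n" if "k \<in> {1..<s}" for k
    proof -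
      have "k + i \<in> {1..<r}" using assms(2) that by auto
      then have "card (\<eta> (k + i) \<inter> \<eta> (k + i + 1)) = n"
        using assms(1) unfolding facet_path_def by blast
      then show ?thesis by (simp add: add.commute add.left_commute)
    qed
  qed (use inj in \<open>simp_all add: o_def\<close>)
qed

text \<open>The window runs from \<open>i\<close> to the first later index \<open>l\<close> at which
  \<open>x\<close> reappears. It has at least three facets because \<open>l\<close> is not
  \<open>i + 1\<close>; the length bound serves the choice of a shortest returning path.\<close>

lemma facet_path_returns:
  assumes "facet_path n F r \<eta>" "1 \<le> i" "i < j" "j \<le> r"
    and "x \<in> \<eta> i" "x \<notin> \<eta> (i + 1)" "x \<in> \<eta> j"
  shows "\<exists>s \<eta>'. s \<le> j + 1 - i \<and> returning_path n F s \<eta>' x"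
proof -
  define l where "l = (LEAST l. i < l \<and> x \<in> \<eta> l)"
  have l: "i < l" "x \<in> \<eta> l" using LeastI[of "\<lambda>l. i < l \<and> x \<in> \<eta> l" j] assms by (auto simp: l_def)
  have min: "x \<notin> \<eta> k" if "i < k" "k < l" for k
    using not_less_Least[of k "\<lambda>l. i < l \<and> x \<in> \<eta> l"] that by (auto simp: l_def)
  have "l \<le> j" using Least_le[of "\<lambda>l. i < l \<and> x \<in> \<eta> l" j] assms by (auto simp: l_def)
  have "l \<noteq> i + 1" using l assms by auto
  have "returning_path n F (l + 1 - i) (\<lambda>k. \<eta> (k + (i - 1))) x"
    unfolding returning_path_def
  proof (intro conjI ballI)
    show "facet_path n F (l + 1 - i) (\<lambda>k. \<eta> (k + (i - 1)))"
      by (rule facet_path_shift[OF assms(1)]) (use l \<open>l \<le> j\<close> assms in auto)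
    show "x \<notin> \<eta> (k + (i - 1))" if "k \<in> {2..l + 1 - i - 1}" for k
      by (rule min) (use that assms(2) in auto)
  qed (use l \<open>l \<noteq> i + 1\<close> assms in auto)
  then show ?thesis using \<open>l \<le> j\<close> by (intro exI[of _ "l + 1 - i"]) auto
qed

text \<open>On a shortest returning path a vertex that leaves after the first facet never comes back, so
  the vertices dropped at the successive steps are distinct; together with the returning vertex
  they are the 0-simplices of a cycle.\<close>

lemma returning_path_imp_cycle:
  assumes n: "1 \<le> n" and K: "abstract_simplicial_complex V K"
    and ret: "returning_path n (simplices K n) r0 \<eta>0 w0"
  shows "\<exists>r \<sigma> \<eta>. cycle_sequence K 0 n r \<sigma> \<eta>"
proof -
  let ?F = "simplices K n"
  \<comment> \<open>Minimal over all paths and all returning vertices, so that a shorter return at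
    any other vertex is also excluded.\<close>
  define r where "r = (LEAST r. \<exists>\<eta> w. returning_path n ?F r \<eta> w)"
  obtain \<eta> w where path: "returning_path n ?F r \<eta> w"
    using LeastI_ex[of "\<lambda>r. \<exists>\<eta> w. returning_path n ?F r \<eta> w"] ret unfolding r_def by blast
  have min: "r \<le> s" if "returning_path n ?F s \<eta>' w'" for s \<eta>' w'
    using Least_le[of "\<lambda>r. \<exists>\<eta> w. returning_path n ?F r \<eta> w" s] that unfolding r_def by blast
  have fp: "facet_path n ?F r \<eta>" and r: "3 \<le> r" and w: "w \<in> \<eta> 1" "w \<in> \<eta> r"
    and avoid: "\<And>k. 2 \<le> k \<Longrightarrow> k < r \<Longrightarrow> w \<notin> \<eta> k"
    using path unfolding returning_path_def by auto
  have F: "\<eta> k \<in> ?F" if "1 \<le> k" "k \<le> r" for k using fp that unfolding facet_path_def by auto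
  have inj: "inj_on \<eta> {1..r}" and injI: "inj_on (\<lambda>k. \<eta> k \<inter> \<eta> (k + 1)) {1..<r}"
    using fp unfolding facet_path_def by auto
  have adj: "card (\<eta> k \<inter> \<eta> (k + 1)) = n" if "1 \<le> k" "k < r" for k
    using fp that unfolding facet_path_def by auto
  have c: "card (\<eta> k) = n + 1" if "1 \<le> k" "k \<le> r" for k
    using F[OF that] unfolding simplices_def by auto
  \<comment> \<open>As \<open>i \<ge> 2\<close>, a return would yield a returning path of at most
    \<open>r - 1\<close> facets.\<close>
  have no_return: "x \<notin> \<eta> j" if ij: "2 \<le> i" "i < j" "j \<le> r" "x \<in> \<eta> i" "x \<notin> \<eta> (i + 1)" for i j x
  proof
    assume "x \<in> \<eta> j"
    then obtain s \<eta>' where "s \<le> j + 1 - i" "returning_path n ?F s \<eta>' x"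
      using facet_path_returns[OF fp _ ij(2,3,4,5)] ij(1) by auto
    then have "r \<le> j + 1 - i" using min order_trans by blast
    then show False using ij by linarith
  qed
  \<comment> \<open>For \<open>z < r\<close> take a vertex dropped after \<open>\<eta> z\<close>.
    Were it missing from \<open>\<eta> (z - 1)\<close> too, both intersections at
    \<open>\<eta> z\<close> would be \<open>\<eta> z - {x}\<close>. For \<open>z = r\<close> any
    vertex of the last intersection will do.\<close>
  have "\<exists>x. x \<in> \<eta> (z - 1) \<inter> \<eta> z \<and> (z < r \<longrightarrow> x \<notin> \<eta> (z + 1))" if z: "2 \<le> z" "z \<le> r" for z
  proof (cases "z < r")
    case True
    have "\<eta> z \<noteq> \<eta> (z + 1)" using inj_onD[OF inj, of z "z + 1"] True z by auto
    then obtain x where x: "x \<in> \<eta> z" "x \<notin> \<eta> (z + 1)"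
      using card_Suc_eq_subset[of "\<eta> z" n "\<eta> (z + 1)"] c[of z] c[of "z + 1"] True z by auto
    have "x \<in> \<eta> (z - 1)"
    proof (rule ccontr)
      assume "x \<notin> \<eta> (z - 1)"
      moreover have "card (\<eta> z \<inter> \<eta> (z - 1)) = n" using adj[of "z - 1"] z by (simp add: Int_commute)
      ultimately have "\<eta> z \<inter> \<eta> (z - 1) = \<eta> z - {x}"
        using inter_eq_remove[OF c] x z by auto
      moreover have "\<eta> z \<inter> \<eta> (z + 1) = \<eta> z - {x}"
        using inter_eq_remove[OF c adj] x z True by auto
      ultimately have "\<eta> (z - 1) \<inter> \<eta> (z - 1 + 1) = \<eta> z \<inter> \<eta> (z + 1)" using z by auto
      moreover have "z - 1 \<in> {1..<r}" "z \<in> {1..<r}" using z True by auto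
      ultimately have "z - 1 = z" using inj_onD[OF injI] by blast
      then show False using z by linarith
    qed
    then show ?thesis using x by blast
  next
    case False
    have "card (\<eta> (z - 1) \<inter> \<eta> z) = n" using adj[of "z - 1"] z by simp
    then have "\<eta> (z - 1) \<inter> \<eta> z \<noteq> {}" using n by auto
    then show ?thesis using False by blast
  qed
  then obtain a where a: "\<And>z. 2 \<le> z \<Longrightarrow> z \<le> r \<Longrightarrow>
      a z \<in> \<eta> (z - 1) \<inter> \<eta> z \<and> (z < r \<longrightarrow> a z \<notin> \<eta> (z + 1))"
    by metis
  \<comment> \<open>The default \<open>w\<close> takes effect at the indices \<open>1\<close> and
    \<open>r + 1\<close>, where it closes the cycle.\<close>
  define b where "b z = (if 2 \<le> z \<and> z \<le> r then a z else w)" for z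
  have b: "b z \<in> \<eta> (z - 1)" "b z \<in> \<eta> z" if "2 \<le> z" "z \<le> r" for z
    using a[OF that] that unfolding b_def by auto
  have b1: "b 1 = w" "b (r + 1) = w" unfolding b_def by auto
  have neq_w: "b z \<noteq> w" if "2 \<le> z" "z \<le> r" for z
  proof (cases "z = r")
    case True
    then show ?thesis using b(1)[OF that] avoid[of "z - 1"] r by auto
  next
    case False
    then show ?thesis using b(2)[OF that] avoid[of z] that by auto
  qed
  \<comment> \<open>For \<open>i \<ge> 2\<close>, the vertex \<open>b i\<close> was dropped after
    \<open>\<eta> i\<close> and is absent from \<open>\<eta> j\<close>, which contains
    \<open>b j\<close>.\<close>
  have neq: "b i \<noteq> b j" if "1 \<le> i" "i < j" "j \<le> r" for i j
  proof (cases "i = 1")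
    case True
    then show ?thesis using neq_w[of j] b1 that by auto
  next
    case False
    then have "b i \<notin> \<eta> j" using a[of i] that
      by (intro no_return[of i j]) (auto simp: b_def)
    then show ?thesis using b(2)[of j] that by auto
  qed
  have injb: "inj_on b {1..r}"
  proof (rule inj_onI)
    fix i j assume "i \<in> {1..r}" "j \<in> {1..r}" "b i = b j"
    then show "i = j" using neq[of i j] neq[of j i] by (cases i j rule: linorder_cases) auto
  qed
  have inK: "t \<in> K" if "t \<subseteq> \<eta> k" "t \<noteq> {}" "1 \<le> k" "k \<le> r" for t k
    using F[OF that(3,4)] K that(1,2) unfolding abstract_simplicial_complex_def simplices_def by blast
  have left: "b k \<in> \<eta> k" and right: "b (k + 1) \<in> \<eta> k" if "k \<in> {1..r}" for k
  proof -
    show "b k \<in> \<eta> k" using b(2)[of k] b1 w that by (cases "k = 1") auto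
    show "b (k + 1) \<in> \<eta> k" using b(1)[of "k + 1"] b1 w that by (cases "k = r") auto
  qed
  have "walk_sequence K 0 n r (\<lambda>z. {b z}) \<eta>"
    unfolding walk_sequence_def
  proof (intro conjI ballI)
    fix k assume k: "k \<in> {1..r + 1}"
    show "{b k} \<in> simplices K 0"
    proof (cases "k = r + 1")
      case True
      then show ?thesis using right[of r] inK[of "{b k}" r] r by (auto simp: simplices_def)
    next
      case False
      then show ?thesis using left[of k] inK[of "{b k}" k] k by (auto simp: simplices_def)
    qed
  next
    fix k assume k: "k \<in> {1..r}"
    show "\<eta> k \<in> simplices K n" using F k by auto
    show "{b k} \<noteq> {b (k + 1)}"
      using neq[of k "k + 1"] neq_w[of r] b1 k r by (cases "k = r") auto
    show "{b k} \<subseteq> \<eta> k" "{b (k + 1)} \<subseteq> \<eta> k" using left right k by auto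
  qed (use r in auto)
  moreover have "inj_on (\<lambda>z. \<eta> (z - 1) \<inter> \<eta> z) {2..r}"
  proof (rule inj_onI)
    fix x y assume xy: "x \<in> {2..r}" "y \<in> {2..r}" "\<eta> (x - 1) \<inter> \<eta> x = \<eta> (y - 1) \<inter> \<eta> y"
    then have "x - 1 + 1 = x" "y - 1 + 1 = y" "x - 1 \<in> {1..<r}" "y - 1 \<in> {1..<r}" by auto
    then have "x - 1 = y - 1" using inj_onD[OF injI, of "x - 1" "y - 1"] xy(3) by metis
    then show "x = y" using xy by auto
  qed
  moreover have "\<eta> (z - 1) \<inter> \<eta> z \<in> simplices K (n - 1)" if "z \<in> {2..r}" for z
  proof -
    have "1 \<le> z - 1" "z - 1 < r" "z - 1 + 1 = z" using that by auto
    then have "card (\<eta> (z - 1) \<inter> \<eta> z) = n" using adj[of "z - 1"] by simp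
    moreover from this have "\<eta> (z - 1) \<inter> \<eta> z \<noteq> {}" using n by auto
    ultimately show ?thesis using inK[of "\<eta> (z - 1) \<inter> \<eta> z" z] that n by (auto simp: simplices_def)
  qed
  moreover have "inj_on (\<lambda>z. {b z}) {1..r}"
    by (rule inj_onI) (metis injb inj_onD singleton_inject)
  moreover have "\<forall>k\<in>{2..r - 1}. \<not> {b 1} \<subseteq> \<eta> k" using avoid b1 by auto
  ultimately have "cycle_sequence K 0 n r (\<lambda>z. {b z}) \<eta>"
    unfolding cycle_sequence_def using inj r
    by (intro conjI exI[of _ "\<lambda>z. \<eta> (z - 1) \<inter> \<eta> z"] ballI) (simp_all add: b[simplified] b1[simplified])
  then show ?thesis by blast
qed

section \<open>Closing walks back to an old vertex\<close>

lemma grown_connected: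
  assumes "grown n T" "A \<in> T" "B \<in> T"
  shows "(\<lambda>x y. x \<in> T \<and> y \<in> T \<and> card (x \<inter> y) = n)\<^sup>*\<^sup>* A B"
  using assms
proof (induction arbitrary: A B)
  case (base \<eta>)
  then show ?case by auto
next
  case (step T \<zeta> \<eta>)
  let ?R = "\<lambda>x y. x \<in> insert \<eta> T \<and> y \<in> insert \<eta> T \<and> card (x \<inter> y) = n"
  have old: "?R\<^sup>*\<^sup>* C D" if "C \<in> T" "D \<in> T" for C D
    using step.IH[OF that] by (rule rtranclp_mono[THEN predicate2D, rotated]) auto
  have "?R \<eta> \<zeta>" "?R \<zeta> \<eta>" using step.hyps by (auto simp: Int_commute)
  then have "?R\<^sup>*\<^sup>* C \<zeta> \<and> ?R\<^sup>*\<^sup>* \<zeta> C" if "C \<in> insert \<eta> T" for C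
    using that old[OF _ step.hyps(2)] old[OF step.hyps(2)] by blast
  then show ?case using step.prems by (meson rtranclp_trans)
qed

text \<open>Repetitions are allowed; a shortest walk will be free of them. The condition on
  \<open>f 2\<close> says that the first step leaves \<open>\<eta>\<close> through the face opposite
  \<open>w\<close>.\<close>

definition closing_walk ::
    "nat \<Rightarrow> 'a set set \<Rightarrow> 'a set \<Rightarrow> 'a \<Rightarrow> nat \<Rightarrow> (nat \<Rightarrow> 'a set) \<Rightarrow> bool" where
  "closing_walk n T \<eta> w r f \<longleftrightarrow>
     2 \<le> r \<and> f 1 = \<eta> \<and> \<eta> - {w} \<subseteq> f 2 \<and> (\<forall>k\<in>{2..r}. f k \<in> T) \<and>
     (\<forall>k\<in>{1..<r}. card (f k \<inter> f (k + 1)) = n) \<and> w \<in> f r"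

text \<open>The facets at positions \<open>i + 1\<close> to \<open>j\<close> are skipped, so later
  indices shift by \<open>j - i\<close>. For \<open>i = 1\<close> the second facet changes, hence
  the extra hypothesis.\<close>

lemma closing_walk_shortcut:
  assumes "closing_walk n T \<eta> w r f" "1 \<le> i" "i < j" "j < r"
    and "card (f i \<inter> f (j + 1)) = n" "i = 1 \<Longrightarrow> \<eta> - {w} \<subseteq> f (j + 1)"
  shows "closing_walk n T \<eta> w (r - (j - i)) (\<lambda>k. if k \<le> i then f k else f (k + (j - i)))"
proof -
  have W: "2 \<le> r" "f 1 = \<eta>" "\<eta> - {w} \<subseteq> f 2" "w \<in> f r"
    and T: "\<And>k. 2 \<le> k \<Longrightarrow> k \<le> r \<Longrightarrow> f k \<in> T"
    and adj: "\<And>k. 1 \<le> k \<Longrightarrow> k < r \<Longrightarrow> card (f k \<inter> f (k + 1)) = n"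
    using assms(1) unfolding closing_walk_def by auto
  show ?thesis
    unfolding closing_walk_def
  proof (intro conjI ballI)
    fix k assume k: "k \<in> {1..<r - (j - i)}"
    consider "k < i" | "k = i" | "i < k" by linarith
    then show "card ((if k \<le> i then f k else f (k + (j - i))) \<inter>
        (if k + 1 \<le> i then f (k + 1) else f (k + 1 + (j - i)))) = n"
    proof cases
      case 1
      then show ?thesis using adj[of k] k assms(3,4) by simp
    next
      case 2
      then show ?thesis using assms by simp
    next
      case 3
      then show ?thesis using adj[of "k + (j - i)"] k by simp
    qed
  next
    show "\<eta> - {w} \<subseteq> (if 2 \<le> i then f 2 else f (2 + (j - i)))"
    proof (cases "2 \<le> i")
      case True
      then show ?thesis using W by simp
    next
      case False
      then have "i = 1" using assms by linarith
      moreover from this have "2 + (j - i) = j + 1" using assms by linarith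
      ultimately show ?thesis using assms(6) by simp
    qed
  qed (use W T assms in auto)
qed

text \<open>A shortest closing walk works: an earlier visit to \<open>w\<close> would allow
  truncation, and a repeated facet or a repeated intersection is ruled out by a shortcut or by the
  special role of the end facets.\<close>

lemma closing_walk_imp_returning_path:
  assumes T: "\<forall>\<zeta>\<in>T. card \<zeta> = n + 1" and \<eta>: "card \<eta> = n + 1" "\<eta> \<notin> T" "w \<in> \<eta>"
    and ex: "closing_walk n T \<eta> w r0 f0"
  shows "\<exists>r f. returning_path n (insert \<eta> T) r f w"
proof -
  define r where "r = (LEAST r. \<exists>f. closing_walk n T \<eta> w r f)"
  obtain f where f: "closing_walk n T \<eta> w r f"
    using LeastI_ex[of "\<lambda>r. \<exists>f. closing_walk n T \<eta> w r f"] ex unfolding r_def by blast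
  have min: "r \<le> s" if "closing_walk n T \<eta> w s g" for s g
    using Least_le[of "\<lambda>r. \<exists>f. closing_walk n T \<eta> w r f" s] that unfolding r_def by blast
  have W: "2 \<le> r" "f 1 = \<eta>" "\<eta> - {w} \<subseteq> f 2" "w \<in> f r"
    and inT: "\<And>k. 2 \<le> k \<Longrightarrow> k \<le> r \<Longrightarrow> f k \<in> T"
    and adj: "\<And>k. 1 \<le> k \<Longrightarrow> k < r \<Longrightarrow> card (f k \<inter> f (k + 1)) = n"
    using f unfolding closing_walk_def by auto
  have c: "card (f k) = n + 1" if "1 \<le> k" "k \<le> r" for k
    using inT[of k] T \<eta> W that by (cases "k = 1") auto
  have avoid: "w \<notin> f k" if "2 \<le> k" "k < r" for k
  proof
    assume "w \<in> f k"
    then have "closing_walk n T \<eta> w k f" using f that unfolding closing_walk_def by auto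
    then show False using min that by fastforce
  qed
  have no_cut: False if "1 \<le> i" "i < j" "j < r" "card (f i \<inter> f (j + 1)) = n"
    "i = 1 \<Longrightarrow> \<eta> - {w} \<subseteq> f (j + 1)" for i j
  proof -
    have "r \<le> r - (j - i)" using closing_walk_shortcut[OF f that] by (rule min)
    then show False using that by linarith
  qed
  have w2: "w \<notin> f 2"
  proof
    assume "w \<in> f 2"
    then have "\<eta> \<subseteq> f 2" using W by blast
    then have "\<eta> = f 2" using card_Suc_eq_subset[OF \<eta>(1) c[of 2]] W(1) by simp
    then show False using inT[of 2] W \<eta> by auto
  qed
  then have "r \<noteq> 2" using W by auto
  then have r: "3 \<le> r" using W by linarith
  have neq: "f i \<noteq> f j" if ij: "1 \<le> i" "i < j" "j \<le> r" for i j
  proof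
    assume eq: "f i = f j"
    consider "i = 1" | "2 \<le> i" "j = r" | "2 \<le> i" "j < r" using ij by linarith
    then show False
    proof cases
      case 1
      then show False using eq W inT[of j] that \<eta> by auto
    next
      case 2
      then show False using eq W avoid[of i] that by auto
    next
      case 3
      then show False using no_cut[of i j] adj[of j] eq that by auto
    qed
  qed
  \<comment> \<open>Equal intersections give \<open>f i\<close> and \<open>f (j + 1)\<close> a
    common set of \<open>n\<close> vertices, so the walk could jump directly; for
    \<open>i = 1\<close> this set contains \<open>\<eta> - {w}\<close>.\<close>
  have neqI: "f i \<inter> f (i + 1) \<noteq> f j \<inter> f (j + 1)" if "1 \<le> i" "i < j" "j < r" for i j
  proof
    assume eq: "f i \<inter> f (i + 1) = f j \<inter> f (j + 1)"
    have "card (f i \<inter> f (j + 1)) \<le> n"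
      using card_inter_le[OF c c neq[of i "j + 1"]] that by auto
    moreover have "finite (f i)" using c[of i] that by (simp add: card_ge_0_finite)
    then have "card (f i \<inter> f (i + 1)) \<le> card (f i \<inter> f (j + 1))"
      using eq by (intro card_mono) auto
    ultimately have "card (f i \<inter> f (j + 1)) = n" using adj[of i] that by auto
    moreover have "\<eta> - {w} \<subseteq> f (j + 1)" if "i = 1"
    proof -
      have "\<eta> - {w} \<subseteq> f i \<inter> f (i + 1)" using W that by (auto simp: numeral_2_eq_2)
      then show ?thesis using eq by blast
    qed
    ultimately show False using no_cut[of i j] that by blast
  qed
  have "facet_path n (insert \<eta> T) r f"
    unfolding facet_path_def
  proof (intro conjI ballI)
    show "f k \<in> insert \<eta> T" if "k \<in> {1..r}" for k
      using inT[of k] W that by (cases "k = 1") auto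
    show "inj_on f {1..r}"
    proof (rule inj_onI)
      fix i j assume "i \<in> {1..r}" "j \<in> {1..r}" "f i = f j"
      then show "i = j" using neq[of i j] neq[of j i] by (cases i j rule: linorder_cases) auto
    qed
    show "inj_on (\<lambda>k. f k \<inter> f (k + 1)) {1..<r}"
    proof (rule inj_onI)
      fix i j assume "i \<in> {1..<r}" "j \<in> {1..<r}" "f i \<inter> f (i + 1) = f j \<inter> f (j + 1)"
      then show "i = j" using neqI[of i j] neqI[of j i] by (cases i j rule: linorder_cases) auto
    qed
  qed (use adj in auto)
  then have "returning_path n (insert \<eta> T) r f w"
    unfolding returning_path_def using r W \<eta> avoid by auto
  then show ?thesis by blast
qed

text \<open>Prefix \<open>\<eta>\<close> to an adjacency path inside \<open>T\<close> from
  \<open>\<zeta>\<close> to a facet containing \<open>w\<close>.\<close>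

lemma grown_ex_closing_walk:
  assumes "grown n T" "\<zeta> \<in> T" "card \<eta> = n + 1" "card (\<eta> \<inter> \<zeta>) = n"
    and "w \<in> \<eta>" "w \<notin> \<zeta>" "w \<in> \<Union>T"
  shows "\<exists>r f. closing_walk n T \<eta> w r f"
proof -
  let ?R = "\<lambda>x y. x \<in> T \<and> y \<in> T \<and> card (x \<inter> y) = n"
  obtain \<theta> where \<theta>: "\<theta> \<in> T" "w \<in> \<theta>" using assms(7) by blast
  obtain s where "(?R ^^ s) \<zeta> \<theta>"
    using rtranclp_imp_relpowp[OF grown_connected[OF assms(1,2) \<theta>(1)]] by blast
  then obtain g where g: "g 0 = \<zeta>" "g s = \<theta>" "\<And>i. i < s \<Longrightarrow> ?R (g i) (g (Suc i))"
    unfolding relpowp_fun_conv by blast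
  have gT: "g i \<in> T" if "i \<le> s" for i
    using g(2) g(3)[of i] \<theta>(1) that by (cases "i = s") auto
  have eq: "\<eta> \<inter> \<zeta> = \<eta> - {w}" using assms by (intro inter_eq_remove) auto
  \<comment> \<open>The path \<open>g\<close> starts at index 0 with \<open>\<zeta>\<close>, which
    becomes position 2.\<close>
  have "closing_walk n T \<eta> w (s + 2) (\<lambda>k. if k \<le> 1 then \<eta> else g (k - 2))"
    unfolding closing_walk_def
  proof (intro conjI ballI)
    fix k assume k: "k \<in> {1..<s + 2}"
    show "card ((if k \<le> 1 then \<eta> else g (k - 2)) \<inter> (if k + 1 \<le> 1 then \<eta> else g (k + 1 - 2))) = n"
    proof (cases "k = 1")
      case True
      then show ?thesis using assms g by simp
    next
      case False
      then have "k + 1 - 2 = Suc (k - 2)" "k - 2 < s" using k by auto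
      then show ?thesis using g(3)[of "k - 2"] False k by simp
    qed
  qed (use g eq gT \<theta> in auto)
  then show ?thesis by blast
qed

lemma facet_path_mono: "facet_path n F r f \<Longrightarrow> F \<subseteq> G \<Longrightarrow> facet_path n G r f"
  unfolding facet_path_def by blast

section \<open>Acyclicity as stackedness, and the equivalence\<close>

text \<open>If the vertex \<open>w\<close> of \<open>\<eta>\<close> outside \<open>\<zeta>\<close>
  were old, a closing walk would give a returning path and then a cycle with \<open>m = 0\<close>,
  which \<open>n \<ge> 1\<close> admits.\<close>

lemma acyclic_imp_stacked:
  assumes "1 \<le> n" "abstract_simplicial_complex V K" "acyclic_complex n K"
    and "grown n T" "T \<subseteq> simplices K n"
  shows "stacked n T"
  using assms(4,5)
proof induction
  case (base \<eta>)
  then show ?case by (simp add: stacked.base)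
next
  case (step T \<zeta> \<eta>)
  have card: "\<forall>\<zeta>\<in>T. card \<zeta> = n + 1" using grown_finite[OF step.hyps(1)] by blast
  have "\<not> \<eta> \<subseteq> \<zeta>" using card_Suc_eq_subset[of \<eta> n \<zeta>] step.hyps card by blast
  then obtain w where w: "w \<in> \<eta>" "w \<notin> \<zeta>" by blast
  have "w \<notin> \<Union>T"
  proof
    assume "w \<in> \<Union>T"
    then obtain r f where "closing_walk n T \<eta> w r f"
      using grown_ex_closing_walk[OF step.hyps(1,2,3,5) w] by blast
    then obtain r f where "returning_path n (insert \<eta> T) r f w"
      using closing_walk_imp_returning_path[OF card step.hyps(3,4) w(1)] by blast
    then have "returning_path n (simplices K n) r f w"
      using facet_path_mono step.prems unfolding returning_path_def by blast
    then show False
      using returning_path_imp_cycle[OF assms(1,2)] assms(1,3) unfolding acyclic_complex_def by auto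
  qed
  then show ?case using step w by (intro stacked.step[of n T \<zeta> \<eta> w]) auto
qed

lemma stacked_imp_acyclic:
  assumes "1 \<le> n" "stacked n (simplices K n)"
  shows "acyclic_complex n K"
  unfolding acyclic_complex_def
proof (intro allI impI notI)
  fix m assume "\<exists>r \<sigma> \<eta>. cycle_sequence K m n r \<sigma> \<eta>"
  then obtain r \<sigma> \<eta> where cyc: "cycle_sequence K m n r \<sigma> \<eta>" by blast
  then have "\<eta> ` {1..r} \<subseteq> simplices K n"
    unfolding cycle_sequence_def walk_sequence_def by blast
  then show False using stacked_no_cycle[OF assms(2,1) cyc] by blast
qed

text \<open>Purity lets the facets determine the complex, so counts for \<open>K\<close> are counts
  for the family of facets.\<close>

lemma pure_facets:
  assumes "pure_simplicial_complex n V K"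
  shows "\<Union>(simplices K n) = V" "simplices K n \<noteq> {}" "finite (simplices K n)"
    and "faces k (simplices K n) = simplices K k"
proof -
  have K: "abstract_simplicial_complex V K" and "complex_dim K = int n"
    and pure: "\<forall>\<tau>\<in>K. \<exists>\<sigma>\<in>simplices K n. \<tau> \<subseteq> \<sigma>"
    using assms unfolding pure_simplicial_complex_def by auto
  then have "K \<noteq> {}" unfolding complex_dim_def by auto
  then show "simplices K n \<noteq> {}" using pure by blast
  have V: "\<forall>\<sigma>\<in>K. \<sigma> \<subseteq> V" "finite V" "\<forall>v\<in>V. {v} \<in> K"
    and closed: "\<And>\<sigma> \<tau>. \<sigma> \<in> K \<Longrightarrow> \<tau> \<noteq> {} \<Longrightarrow> \<tau> \<subseteq> \<sigma> \<Longrightarrow> \<tau> \<in> K"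
    using K unfolding abstract_simplicial_complex_def by blast+
  show "finite (simplices K n)"
    by (rule finite_subset[of _ "Pow V"]) (use V in \<open>auto simp: simplices_def\<close>)
  show "\<Union>(simplices K n) = V"
  proof
    show "\<Union>(simplices K n) \<subseteq> V" using V by (auto simp: simplices_def)
    show "V \<subseteq> \<Union>(simplices K n)"
    proof
      fix v assume "v \<in> V"
      then have "{v} \<in> K" using V by blast
      then show "v \<in> \<Union>(simplices K n)" using pure by blast
    qed
  qed
  show "faces k (simplices K n) = simplices K k"
  proof
    show "faces k (simplices K n) \<subseteq> simplices K k"
    proof
      fix s assume "s \<in> faces k (simplices K n)"
      then obtain \<eta> where s: "card s = k + 1" "\<eta> \<in> K" "s \<subseteq> \<eta>"
        unfolding faces_def simplices_def by blast
      then have "s \<noteq> {}" by auto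
      then show "s \<in> simplices K k" using s closed unfolding simplices_def by blast
    qed
    show "simplices K k \<subseteq> faces k (simplices K n)"
      using pure by (auto simp: faces_def simplices_def)
  qed
qed

theorem theorem5p4:
  fixes n p :: nat and V :: "'a set" and K :: "'a set set"
  assumes "1 \<le> n"
    and "pure_simplicial_complex n V K"
    and "card V = p"
  shows "simplicial_tree n V K \<longleftrightarrow>
    connected_complex n K \<and>
    (\<exists>k. 1 \<le> k \<and> k \<le> n \<and>
       int (num_simplices K k) =
         (int p - int n) * int (n choose k) + int (n choose (k + 1)))"
proof (cases "connected_complex n K")
  case False
  then show ?thesis unfolding simplicial_tree_def by blast
next
  case True
  let ?F = "simplices K n"
  have K: "abstract_simplicial_complex V K"
    using assms(2) unfolding pure_simplicial_complex_def by blast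
  note F = pure_facets[OF assms(2)]
  have grown: "grown n ?F" by (rule connected_imp_grown[OF assms(1) K True F(2,3)])
  have count: "int (num_simplices K k) = (int p - int n) * int (n choose k) + int (n choose (k + 1))
      \<longleftrightarrow> int (card (faces k ?F)) = tree_count n k ?F" for k
    unfolding num_simplices_def tree_count_def F(1,4) assms(3) ..
  have "simplicial_tree n V K \<longleftrightarrow> acyclic_complex n K"
    using assms(2) True unfolding simplicial_tree_def by blast
  also have "\<dots> \<longleftrightarrow> stacked n ?F"
    using stacked_imp_acyclic acyclic_imp_stacked[OF assms(1) K _ grown] assms(1) by blast
  \<comment> \<open>Stackedness gives equality for every \<open>k\<close>, and the range is nonempty
    as \<open>n \<ge> 1\<close>; conversely, equality for one \<open>k\<close> in range rules out
    the strict excess.\<close>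
  also have "\<dots> \<longleftrightarrow> (\<exists>k. 1 \<le> k \<and> k \<le> n \<and> int (card (faces k ?F)) = tree_count n k ?F)"
    using stacked_card_faces grown_card_faces[OF grown] assms(1) by fastforce
  finally show ?thesis using True unfolding count by blast
qed

end
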